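(* The Grassmann graph $J_q(n,k)$ with $q$ odd yields a binary even LCD code if and only if $n$ is odd. If $q$ is even, then $J_q(n,k)$ never yields a binary even LCD code.
   Context: Here $\mathbb{F}_q$ is the finite field with $q$ elements. The Grassmann graph $J_q(n,k)$ has as vertices the $k$-dimensional subspaces of $\mathbb{F}_q^n$, two being adjacent when their intersection has dimension $k-1$; its diameter is $\min(k,n-k)$. A binary code of length $N$ is a linear subspace $C\subseteq\mathbb{F}_2^N$. Its dual $C^\perp$ is taken with respect to $\langle x,y\rangle=\sum_i x_iy_i$. $C$ is LCD (linear complementary dual) if $C\cap C^\perp=\{0\}$, equivalently $\mathbb{F}_2^N=C\oplus C^\perp$. $C$ is even if every codeword has even Hamming weight. For an LCD code $C$, the orthogonal projector $\Pi_C$ is the unique $N\times N$ matrix over $\mathbb{F}_2$ with $v\Pi_C=v$ for all row vectors $v\in C$ and $v\Pi_C=0$ for all $v\in C^\perp$. A finite simple graph on $N$ (ordered) vertices with adjacency matrix $A$ is said to yield a binary even LCD code if $A$, read over $\mathbb{F}_2$, equals $\Pi_C$ for some binary even LCD code $C$ of length $N$ (equivalently, $A^2=A$ over $\mathbb{F}_2$); this $C$, which is the row span of $A$ over $\mathbb{F}_2$, is the code yielded by the graph.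
   Formalization: For q odd, 1 ≤ k ≤ n−1 is assumed (one-vertex graphs k=0,n always yield the zero code); for q even, 2 ≤ k ≤ n−2 is assumed, since for k=1 or n−1 the graph is complete of odd order and does yield an even LCD code (e.g. J_2(2,1)=K_3). *)

theory Defs
  imports "HOL-Analysis.Analysis" "HOL-Library.Z2"
begin

section \<open>Binary codes\<close>

text \<open>
  Words of length $N$ over the two-element field are vectors of type \<^typ>\<open>bit ^ 'v\<close> with
  $N$ the cardinality of \<^typ>\<open>'v\<close>.
\<close>

definition binary_code :: "(bit ^ 'v) set \<Rightarrow> bool" where
  "binary_code C \<longleftrightarrow> vec.subspace C"

definition dual_code :: "(bit ^ 'v) set \<Rightarrow> (bit ^ 'v) set" where
  "dual_code C = {x. \<forall>y\<in>C. scalar_product x y = 0}"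

definition LCD :: "(bit ^ 'v) set \<Rightarrow> bool" where
  "LCD C \<longleftrightarrow> C \<inter> dual_code C = {0}"

definition hamming_weight :: "bit ^ 'v \<Rightarrow> nat" where
  "hamming_weight x = card {i. x $ i \<noteq> 0}"

definition even_code :: "(bit ^ 'v) set \<Rightarrow> bool" where
  "even_code C \<longleftrightarrow> (\<forall>x\<in>C. even (hamming_weight x))"

text \<open>Only meaningful for LCD codes, see \<open>ex1_orth_projector\<close> below.\<close>

definition orth_projector :: "(bit ^ 'v) set \<Rightarrow> bit ^ 'v ^ 'v" where
  "orth_projector C = (THE P. (\<forall>x\<in>C. x v* P = x) \<and> (\<forall>x\<in>dual_code C. x v* P = 0))"

instance bit :: finite
proof
  have "(UNIV :: bit set) \<subseteq> {0, 1}"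
    using bit_not_zero_iff by blast
  then show "finite (UNIV :: bit set)"
    by (rule finite_subset) simp
qed

lemma scalar_product_add_left: "scalar_product (x + y) z = scalar_product x z + scalar_product y z"
  by (simp add: scalar_product_def distrib_right sum.distrib)

lemma scalar_product_diff_left:
  fixes x y z :: "'a::ring_1 ^ 'v"
  shows "scalar_product (x - y) z = scalar_product x z - scalar_product y z"
  by (simp add: scalar_product_def left_diff_distrib sum_subtractf)

lemma scalar_product_scale_left: "scalar_product (c *s x) y = c * scalar_product x y"
  by (simp add: scalar_product_def sum_distrib_left mult.assoc)

lemma scalar_product_commute:
  fixes x y :: "'a::comm_semiring_1 ^ 'v"
  shows "scalar_product x y = scalar_product y x"
  by (simp add: scalar_product_def mult.commute)

lemma subspace_dual_code: "vec.subspace (dual_code C)"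
  unfolding vec.subspace_def dual_code_def
  by (simp add: scalar_product_add_left scalar_product_scale_left)
     (simp add: scalar_product_def)

lemma LCD_decomposition:
  assumes C: "binary_code C" and lcd: "LCD C"
  shows "\<exists>c\<in>C. x - c \<in> dual_code C"
proof -
  have sub: "vec.subspace C" using C by (simp add: binary_code_def)
  obtain B where B: "B \<subseteq> C" "vec.independent B" "C \<subseteq> vec.span B"
    by (rule vec.basis_exists[of C])
  define T where "T y = (\<Sum>b\<in>B. scalar_product y b *s b)" for y
  have T_diff: "T (y - z) = T y - T z" for y z
    unfolding T_def by (simp only: scalar_product_diff_left vec.scale_left_diff_distrib sum_subtractf)
  have T_C: "T y \<in> C" for y
    unfolding T_def by (intro vec.subspace_sum[OF sub] vec.subspace_scale[OF sub] subsetD[OF B(1)])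
  have dual: "y \<in> dual_code C" if "T y = 0" for y
  proof -
    have "\<forall>b\<in>B. scalar_product y b = 0"
      using vec.independentD[OF B(2) finite order_refl that[unfolded T_def]] by blast
    then have "B \<subseteq> dual_code {y}"
      by (auto simp only: dual_code_def scalar_product_commute[of _ y])
    then have "C \<subseteq> dual_code {y}"
      by (rule order_trans[OF B(3) vec.span_minimal[OF _ subspace_dual_code]])
    then have "\<forall>b\<in>C. scalar_product b y = 0"
      unfolding dual_code_def by blast
    then show ?thesis
      unfolding dual_code_def by (simp only: scalar_product_commute[of y] mem_Collect_eq)
  qed
  have "inj_on T C"
  proof (rule inj_onI)
    fix y z assume yz: "y \<in> C" "z \<in> C" "T y = T z"
    then have "y - z \<in> dual_code C" by (intro dual) (simp only: T_diff diff_self)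
    moreover have "y - z \<in> C" by (rule vec.subspace_diff[OF sub yz(1,2)])
    ultimately have "y - z \<in> C \<inter> dual_code C" by (rule IntI[rotated])
    then show "y = z" using lcd by (simp only: LCD_def singleton_iff right_minus_eq)
  qed
  then have "T ` C = C" using T_C by (intro endo_inj_surj) auto
  then have "T x \<in> T ` C" using T_C by simp
  then obtain c where c: "c \<in> C" "T x = T c" by auto
  have "T (x - c) = 0" by (simp only: T_diff c(2) diff_self)
  then show ?thesis using dual c(1) by blast
qed

lemma diff_diff_same: "(x - c) - (x - d) = d - (c::'a::ab_group_add)"
  by simp

lemma ex1_orth_projector:
  assumes C: "binary_code C" and lcd: "LCD C"
  shows "\<exists>!P. (\<forall>x\<in>C. x v* P = x) \<and> (\<forall>x\<in>dual_code C. x v* P = 0)"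
proof -
  have sub: "vec.subspace C" using C by (simp add: binary_code_def)
  obtain p where p: "\<And>x. p x \<in> C" "\<And>x. x - p x \<in> dual_code C"
    using LCD_decomposition[OF C lcd] by metis
  have p_eq: "p x = c" if "c \<in> C" "x - c \<in> dual_code C" for x c
  proof -
    have "p x - c \<in> C" by (rule vec.subspace_diff[OF sub p(1) that(1)])
    moreover have "(x - c) - (x - p x) \<in> dual_code C"
      by (rule vec.subspace_diff[OF subspace_dual_code that(2) p(2)])
    moreover have "(x - c) - (x - p x) = p x - c" by (rule diff_diff_same)
    ultimately have "p x - c \<in> C \<inter> dual_code C" by (simp only: Int_iff)
    then show ?thesis using lcd by (simp only: LCD_def singleton_iff right_minus_eq)
  qed
  have lin: "Vector_Spaces.linear (*s) (*s) p"
  proof (intro Vector_Spaces.linear_iff[THEN iffD2] conjI allI vec.vector_space_axioms)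
    fix x y :: "bit ^ 'a" and a :: bit
    have "x + y - (p x + p y) \<in> dual_code C"
      unfolding add_diff_add by (rule vec.subspace_add[OF subspace_dual_code p(2) p(2)])
    then show "p (x + y) = p x + p y"
      by (rule p_eq[OF vec.subspace_add[OF sub p(1) p(1)]])
    have "a *s x - a *s p x \<in> dual_code C"
      unfolding vec.scale_right_diff_distrib[symmetric]
      by (rule vec.subspace_scale[OF subspace_dual_code p(2)])
    then show "p (a *s x) = a *s p x"
      by (rule p_eq[OF vec.subspace_scale[OF sub p(1)]])
  qed
  define P where "P = transpose (matrix p)"
  have P: "x v* P = p x" for x
    using matrix_works[OF lin] by (simp add: P_def)
  show ?thesis
  proof (rule ex1I[of _ P])
    show "(\<forall>x\<in>C. x v* P = x) \<and> (\<forall>x\<in>dual_code C. x v* P = 0)"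
      using sub subspace_dual_code[of C] by (auto simp: P vec.subspace_0 intro!: p_eq)
  next
    fix Q assume Q: "(\<forall>x\<in>C. x v* Q = x) \<and> (\<forall>x\<in>dual_code C. x v* Q = 0)"
    have "x v* Q = x v* P" for x
    proof -
      have "x v* Q = p x v* Q + (x - p x) v* Q"
        by (simp only: vector_matrix_left_distrib[symmetric] add_diff_eq add_diff_cancel_left')
      moreover have "p x v* Q = p x" "(x - p x) v* Q = 0" using Q p by blast+
      ultimately show ?thesis by (simp only: P add_0_right)
    qed
    then have "transpose Q *v x = transpose P *v x" for x by simp
    then have "transpose Q = transpose P" by (simp add: matrix_eq)
    then show "Q = P" by (metis transpose_transpose)
  qed
qed


section \<open>Graphs and the codes they yield\<close>

text \<open>
  A finite simple graph is given by a symmetric, irreflexive adjacency relation \<open>adj\<close> on a finite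
  vertex set \<open>V\<close>; an ordering of its $N$ vertices is a bijection from an $N$-element index
  type \<^typ>\<open>'v\<close> onto \<open>V\<close>.
\<close>

definition adjacency_matrix :: "('a \<Rightarrow> 'a \<Rightarrow> bool) \<Rightarrow> ('v::finite \<Rightarrow> 'a) \<Rightarrow> bit ^ 'v ^ 'v" where
  "adjacency_matrix adj ord = (\<chi> i j. if adj (ord i) (ord j) then 1 else 0)"

definition yields_even_LCD_code :: "('a \<Rightarrow> 'a \<Rightarrow> bool) \<Rightarrow> ('v::finite \<Rightarrow> 'a) \<Rightarrow> bool" where
  "yields_even_LCD_code adj ord \<longleftrightarrow>
     (\<exists>C. binary_code C \<and> LCD C \<and> even_code C \<and> adjacency_matrix adj ord = orth_projector C)"


section \<open>Grassmann graphs\<close>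

text \<open>
  For $J_q(n,k)$ the field with $q$ elements is a finite field type \<^typ>\<open>'q\<close> and $n$ is the
  cardinality of \<^typ>\<open>'n\<close>.

  Degenerate parameters: for $k = 0$ and $k = n$ the graph is a single vertex and yields the zero
  code; for $k = 1$ and $k = n - 1$ (diameter $1$) it is a complete graph, of odd order if $q$ is
  even, and then its adjacency matrix is idempotent over the two-element field.  Hence a negative
  result for even $q$ has to assume diameter at least $2$.
\<close>

definition grassmann_vertices :: "nat \<Rightarrow> ('q::{finite,field} ^ 'n) set set" where
  "grassmann_vertices k = {S. vec.subspace S \<and> vec.dim S = k}"

text \<open>Written without \<open>k - 1\<close> so that truncated subtraction does not create loops for \<open>k = 0\<close>.\<close>

definition grassmann_adj :: "nat \<Rightarrow> ('q::{finite,field} ^ 'n) set \<Rightarrow> ('q ^ 'n) set \<Rightarrow> bool" where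
  "grassmann_adj k S T \<longleftrightarrow> vec.dim (S \<inter> T) + 1 = k"

lemma grassmann_adj_sym: "grassmann_adj k S T \<Longrightarrow> grassmann_adj k T S"
  by (simp add: grassmann_adj_def Int_commute)

lemma grassmann_adj_irrefl: "S \<in> grassmann_vertices k \<Longrightarrow> \<not> grassmann_adj k S S"
  by (simp add: grassmann_adj_def grassmann_vertices_def)

end

theory Submission
  imports Defs
begin

text \<open>
  A graph yields an even LCD code iff its adjacency matrix \<open>A\<close> is idempotent over the two-element
  field: the zero diagonal of \<open>A = A\<^sup>2 = A A\<^sup>T\<close> makes all row sums vanish, hence the code even.

  Let \<open>k = m + 1\<close>, let \<open>M\<close> be the incidence matrix of \<open>(m+1)\<close>- versus \<open>m\<close>-subspaces, \<open>N\<close> that of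
  \<open>m\<close>- versus \<open>(m-1)\<close>-subspaces, and \<open>[e] = 1 + q + \<dots> + q\<^bsup>e-1\<^esup>\<close>.  Then \<open>A = M M\<^sup>T - [m+1] I\<close>, and
  the dimension formula gives \<open>M\<^sup>T M = N N\<^sup>T + ([n-m] - [m]) I\<close>.  Consequently
  \<open>M M\<^sup>T M M\<^sup>T = (M N) (M N)\<^sup>T + ([n-m] - [m]) M M\<^sup>T\<close>, where \<open>M N\<close> is \<open>q + 1\<close> times the incidence
  matrix of \<open>(m+1)\<close>- versus \<open>(m-1)\<close>-subspaces.  For odd \<open>q\<close> the first summand vanishes mod 2 and
  the coefficient of the second is congruent to \<open>n\<close>; for even \<open>q\<close> the coefficient vanishes and
  two vertices at distance 2 have an odd number of common neighbours.
\<close>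

section \<open>Matrices that yield even LCD codes\<close>

text \<open>By the LCD splitting each word is some \<open>c\<close> in the code plus a dual word;
  the projector sends it to \<open>c\<close>, and a second application fixes
  \<open>c\<close>.\<close>

lemma idempotent_adjacency_matrix_if_yields:
  assumes "yields_even_LCD_code adj ord"
  shows "adjacency_matrix adj ord ** adjacency_matrix adj ord = adjacency_matrix adj ord"
proof -
  obtain C where C: "binary_code C" "LCD C" and A: "adjacency_matrix adj ord = orth_projector C"
    using assms by (auto simp: yields_even_LCD_code_def)
  define P where "P = orth_projector C"
  have "(\<forall>x\<in>C. x v* P = x) \<and> (\<forall>x\<in>dual_code C. x v* P = 0)"
    unfolding P_def orth_projector_def by (rule theI'[OF ex1_orth_projector[OF C]])
  then have fix_C: "\<And>x. x \<in> C \<Longrightarrow> x v* P = x" and kill: "\<And>x. x \<in> dual_code C \<Longrightarrow> x v* P = 0"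
    by blast+
  have "x v* (P ** P) = x v* P" for x
  proof -
    obtain c where c: "c \<in> C" "x - c \<in> dual_code C"
      using LCD_decomposition[OF C] by blast
    have "x v* P = (c + (x - c)) v* P"
      by (simp only: add_diff_eq add_diff_cancel_left')
    also have "\<dots> = c"
      using fix_C[OF c(1)] kill[OF c(2)] by (simp only: vector_matrix_left_distrib add_0_right)
    finally have "x v* P = c" .
    then show ?thesis
      by (simp only: vector_matrix_mul_assoc[symmetric] fix_C[OF c(1)])
  qed
  \<comment> \<open>\<open>matrix_eq\<close> compares matrices through \<open>*v\<close>, so the
    row-vector identity is read for the transposes.\<close>
  then have "transpose (P ** P) *v x = transpose P *v x" for x by simp
  then have "transpose (P ** P) = transpose P" by (simp add: matrix_eq)
  then have "P ** P = P" by (metis transpose_transpose)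
  then show ?thesis using A P_def by simp
qed

lemma scalar_product_vector_matrix:
  fixes x :: "'a::comm_semiring_1 ^ 'v"
  shows "scalar_product (x v* A) y = scalar_product x (A *v y)"
  unfolding scalar_product_def vector_matrix_mult_def matrix_vector_mult_def
  by (simp add: sum_distrib_left sum_distrib_right mult.assoc) (subst sum.swap, simp add: ac_simps)

text \<open>Over F_2 the coordinate sum is the parity of the weight, so vanishing row sums of
  \<open>A\<close> force every word \<open>x v* A\<close> to be even.\<close>

lemma sum_vector_matrix_mult:
  fixes x :: "'a::comm_semiring_1 ^ 'v"
  shows "(\<Sum>j\<in>UNIV. (x v* A) $ j) = (\<Sum>i\<in>UNIV. x $ i * (\<Sum>j\<in>UNIV. A $ i $ j))"
  unfolding vector_matrix_mult_def
  by (simp add: sum_distrib_left) (subst sum.swap, simp add: mult.commute)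

lemma scalar_product_eq_0_imp:
  fixes x :: "'a::comm_semiring_1 ^ 'v"
  assumes "\<And>y. scalar_product x y = 0"
  shows "x = 0"
proof -
  have "x $ i = scalar_product x (axis i 1)" for i
    by (simp add: scalar_product_def axis_def if_distrib cong: if_cong)
  then show ?thesis using assms by (simp add: vec_eq_iff)
qed

lemma of_nat_hamming_weight: "of_nat (hamming_weight x) = (\<Sum>i\<in>UNIV. x $ i)"
proof -
  have "(\<Sum>i\<in>UNIV. x $ i) = (\<Sum>i\<in>UNIV. of_bool (x $ i \<noteq> 0))"
    by (rule sum.cong) (auto simp: bit_not_zero_iff)
  then show ?thesis by (simp add: hamming_weight_def)
qed

lemma even_iff_of_nat_bit: "even n \<longleftrightarrow> (of_nat n :: bit) = 0"
  by (induction n) auto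

text \<open>The code is the row space. Idempotence makes the matrix fix this space, symmetry makes
  it annihilate the dual, and uniqueness of the projector concludes.\<close>

lemma yields_if_idempotent_adjacency_matrix:
  fixes ord :: "'v::finite \<Rightarrow> 'a"
  assumes idem: "adjacency_matrix adj ord ** adjacency_matrix adj ord = adjacency_matrix adj ord"
    and sym: "\<And>i j. adj (ord i) (ord j) \<Longrightarrow> adj (ord j) (ord i)"
    and irrefl: "\<And>i. \<not> adj (ord i) (ord i)"
  shows "yields_even_LCD_code adj ord"
proof -
  define A where "A = adjacency_matrix adj ord"
  have AA: "A ** A = A" using idem by (simp add: A_def)
  have A_sym: "A $ i $ j = A $ j $ i" for i j
    using sym by (auto simp: A_def adjacency_matrix_def)
  then have trA: "transpose A = A" by (simp add: transpose_def vec_eq_iff)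
  have Av: "A *v x = x v* A" for x
    using transpose_matrix_vector[of A x] trA by simp
  have row_sum: "(\<Sum>j\<in>UNIV. A $ i $ j) = 0" for i
  proof -
    \<comment> \<open>A bit is its own square, so by symmetry a row sum is a diagonal entry of
      \<open>A ** A = A\<close>, which irreflexivity makes zero.\<close>
    have "(\<Sum>j\<in>UNIV. A $ i $ j) = (\<Sum>j\<in>UNIV. A $ i $ j * A $ j $ i)"
    proof (rule sum.cong)
      fix j show "A $ i $ j = A $ i $ j * A $ j $ i"
        unfolding A_sym[of j i] by (cases "A $ i $ j") auto
    qed simp
    also have "\<dots> = (A ** A) $ i $ i" by (simp add: matrix_matrix_mult_def)
    also have "\<dots> = 0" unfolding AA using irrefl by (simp add: A_def adjacency_matrix_def)
    finally show ?thesis .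
  qed
  define C where "C = range (\<lambda>x. x v* A)"
  have fix_C: "x v* A = x" if x: "x \<in> C" for x
    using x by (auto simp: C_def vector_matrix_mul_assoc AA)
  have kill: "x v* A = 0" if x: "x \<in> dual_code C" for x
  proof (rule scalar_product_eq_0_imp)
    fix y
    \<comment> \<open>\<open>A\<close> is self-adjoint, and \<open>y v* A\<close> is a
      codeword.\<close>
    have "scalar_product (x v* A) y = scalar_product x (y v* A)"
      by (simp add: scalar_product_vector_matrix Av)
    also have "\<dots> = 0" using x by (simp add: dual_code_def C_def)
    finally show "scalar_product (x v* A) y = 0" .
  qed
  have code: "binary_code C"
    unfolding binary_code_def vec.subspace_def
  proof (intro conjI allI ballI)
    show "0 \<in> C" by (auto simp: C_def intro: range_eqI[of _ _ 0])
  next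
    fix x y assume "x \<in> C" "y \<in> C"
    then have "x + y = (x + y) v* A"
      by (simp only: vector_matrix_left_distrib fix_C)
    then show "x + y \<in> C" by (auto simp: C_def)
  next
    fix c :: bit and x assume "x \<in> C"
    then have "c *s x = (c *s x) v* A"
      using fix_C by (cases c) auto
    then show "c *s x \<in> C" by (auto simp: C_def)
  qed
  have lcd: "LCD C"
    unfolding LCD_def
  proof
    show "C \<inter> dual_code C \<subseteq> {0}" using fix_C kill by force
    show "{0} \<subseteq> C \<inter> dual_code C"
      using vec.subspace_0[OF subspace_dual_code[of C]] vec.subspace_0[of C] code
      by (auto simp: binary_code_def)
  qed
  have even: "even_code C"
    unfolding even_code_def
  proof
    fix x assume "x \<in> C"
    have "(\<Sum>j\<in>UNIV. x $ j) = (\<Sum>j\<in>UNIV. (x v* A) $ j)"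
      using fix_C[OF \<open>x \<in> C\<close>] by simp
    also have "\<dots> = (\<Sum>i\<in>UNIV. x $ i * (\<Sum>j\<in>UNIV. A $ i $ j))"
      by (rule sum_vector_matrix_mult)
    also have "\<dots> = 0" by (simp add: row_sum)
    finally show "even (hamming_weight x)"
      by (simp add: even_iff_of_nat_bit of_nat_hamming_weight)
  qed
  have "orth_projector C = A"
    unfolding orth_projector_def using fix_C kill
    by (intro the1_equality[OF ex1_orth_projector[OF code lcd]]) blast
  then show ?thesis
    unfolding yields_even_LCD_code_def using code lcd even A_def by metis
qed

section \<open>Counting subspaces\<close>

text \<open>For a field of order q this is (q^e - 1)/(q - 1), the number of one-dimensional
  subspaces of an e-dimensional space.\<close>

definition qint :: "nat \<Rightarrow> nat \<Rightarrow> nat" where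
  "qint q e = (\<Sum>i<e. q ^ i)"

lemma qint_Suc: "qint q (Suc e) = qint q e + q ^ e"
  by (simp add: qint_def)

lemma even_qint_of_odd: "odd q \<Longrightarrow> even (qint q e) \<longleftrightarrow> even e"
  by (induction e) (auto simp: qint_def)

text \<open>\<open>q ^ 0\<close> is the only odd summand.\<close>

lemma odd_qint_of_even: "even q \<Longrightarrow> odd (qint q (Suc e))"
  by (induction e) (auto simp: qint_def)

lemma qint_mult: "(int q - 1) * int (qint q e) = int q ^ e - 1"
  by (simp add: qint_def power_diff_1_eq)

lemma two_le_card_field: "2 \<le> CARD('q::{finite,field})"
proof -
  have "card {0::'q, 1} \<le> CARD('q)" by (rule card_mono) auto
  then show ?thesis by simp
qed

text \<open>Each vector of the span is \<open>r + c *s v\<close> for exactly one pair: two different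
  coefficients would put a nonzero multiple of \<open>v\<close>, hence \<open>v\<close> itself, into
  \<open>R\<close>.\<close>

lemma card_span_insert:
  fixes v :: "'q::{finite,field} ^ 'n"
  assumes R: "vec.subspace R" and v: "v \<notin> R"
  shows "card (vec.span (insert v R)) = CARD('q) * card R"
proof -
  have span_R: "vec.span R = R" using R by (simp only: vec.span_eq_iff)
  have "bij_betw (\<lambda>(c, r). r + c *s v) (UNIV \<times> R) (vec.span (insert v R))"
    unfolding bij_betw_def
  proof
    show "inj_on (\<lambda>(c, r). r + c *s v) (UNIV \<times> R)"
    proof (clarsimp simp: inj_on_def)
      fix c r d s assume rs: "r \<in> R" "s \<in> R" and eq: "r + c *s v = s + d *s v"
      have diff: "(c - d) *s v = s - r"
        using eq by (simp only: vec.scale_left_diff_distrib) (simp add: algebra_simps)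
      have "c = d"
      proof (rule ccontr)
        assume "c \<noteq> d"
        then have "v = inverse (c - d) *s ((c - d) *s v)"
          by (simp only: vec.scale_scale left_inverse right_minus_eq not_False_eq_True vec.scale_one)
        also have "\<dots> \<in> R"
          unfolding diff by (intro vec.subspace_scale[OF R] vec.subspace_diff[OF R] rs)
        finally show False using v by simp
      qed
      then show "c = d \<and> r = s" using eq by simp
    qed
    show "(\<lambda>(c, r). r + c *s v) ` (UNIV \<times> R) = vec.span (insert v R)"
      unfolding vec.span_insert span_R
    proof (intro equalityI subsetI)
      fix x assume "x \<in> (\<lambda>(c, r). r + c *s v) ` (UNIV \<times> R)"
      then obtain c r where "r \<in> R" "x = r + c *s v" by auto
      then have "x - c *s v \<in> R" by (simp only: add_diff_cancel_right')
      then show "x \<in> {x. \<exists>k. x - k *s v \<in> R}" by blast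
    next
      fix x assume "x \<in> {x. \<exists>k. x - k *s v \<in> R}"
      then obtain k where "x - k *s v \<in> R" by blast
      then show "x \<in> (\<lambda>(c, r). r + c *s v) ` (UNIV \<times> R)"
        by (intro image_eqI[of _ _ "(k, x - k *s v)"]) simp_all
    qed
  qed
  then have "card (UNIV \<times> R :: ('q \<times> _) set) = card (vec.span (insert v R))"
    by (rule bij_betw_same_card)
  then show ?thesis by (simp add: card_cartesian_product)
qed

lemma dim_span_insert:
  fixes v :: "'q::field ^ 'n"
  assumes "vec.subspace R" "v \<notin> R"
  shows "vec.dim (vec.span (insert v R)) = Suc (vec.dim R)"
proof -
  have "v \<notin> vec.span R" using assms by (metis vec.span_eq_iff)
  then show ?thesis by (simp add: vec.dim_insert)
qed

text \<open>Each new basis vector multiplies the size by the order of the field.\<close>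

lemma card_subspace:
  fixes S :: "('q::{finite,field} ^ 'n) set"
  assumes "vec.subspace S"
  shows "card S = CARD('q) ^ vec.dim S"
proof -
  have "card (vec.span B) = CARD('q) ^ vec.dim B" if "vec.independent B" for B :: "('q ^ 'n) set"
    using finite[of B] that
  proof (induction B rule: finite_induct)
    case empty
    then show ?case by simp
  next
    case (insert b B)
    have ind: "vec.independent B" and b: "b \<notin> vec.span B"
      using insert.prems insert.hyps by (auto simp: vec.independent_insert)
    have "vec.span (insert b (vec.span B)) = vec.span (insert b B)"
      by (simp add: vec.span_insert vec.span_span)
    moreover have "vec.dim (insert b B) = Suc (vec.dim B)"
      using b by (simp add: vec.dim_insert)
    ultimately show ?case
      using card_span_insert[OF vec.subspace_span b] insert.IH[OF ind] by simp
  qed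
  moreover obtain B where "B \<subseteq> S" "vec.independent B" "S \<subseteq> vec.span B"
    by (rule vec.basis_exists[of S])
  moreover from this have "vec.span B = S"
    using assms by (metis vec.span_subspace)
  ultimately show ?thesis by (metis vec.dim_span)
qed

lemma subspace_eq_of_dim:
  fixes S T :: "('q::field ^ 'n) set"
  assumes "vec.subspace S" "vec.subspace T" "S \<subseteq> T" "vec.dim T \<le> vec.dim S"
  shows "S = T"
  using vec.subspace_dim_equal assms by blast

text \<open>The sets \<open>U - R\<close> partition \<open>X - R\<close>, and each has q^(d+1) - q^d
  elements, where d is the dimension of \<open>R\<close>. Dividing q^(d+e) - q^d by this gives
  [e].\<close>

lemma card_subspaces_above:
  fixes R X :: "('q::{finite,field} ^ 'n) set"
  assumes R: "vec.subspace R" and X: "vec.subspace X" and RX: "R \<subseteq> X"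
    and dim: "vec.dim X = vec.dim R + e"
  shows "card {U \<in> grassmann_vertices (Suc (vec.dim R)). R \<subseteq> U \<and> U \<subseteq> X} = qint CARD('q) e"
proof -
  define q d where "q = CARD('q)" and "d = vec.dim R"
  define F where "F = {U \<in> grassmann_vertices (Suc d). R \<subseteq> U \<and> U \<subseteq> X}"
  have F: "vec.subspace U" "vec.dim U = Suc d" "R \<subseteq> U" "U \<subseteq> X" if "U \<in> F" for U
    using that by (auto simp: F_def grassmann_vertices_def)
  \<comment> \<open>\<open>U\<close> is determined by any of its vectors outside \<open>R\<close>;
    hence the blocks are disjoint.\<close>
  have span_F: "U = vec.span (insert v R)" if U: "U \<in> F" and v: "v \<in> U - R" for U v
  proof (rule subspace_eq_of_dim[symmetric])
    show "vec.span (insert v R) \<subseteq> U"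
      using F[OF U] v by (intro vec.span_minimal) auto
    show "vec.dim U \<le> vec.dim (vec.span (insert v R))"
      using dim_span_insert[OF R] F[OF U] v by (auto simp: d_def)
  qed (use F[OF U] in auto)
  have "X - R = (\<Union>U\<in>F. U - R)"
  proof
    show "X - R \<subseteq> (\<Union>U\<in>F. U - R)"
    proof
      fix v assume v: "v \<in> X - R"
      have "vec.span (insert v R) \<subseteq> X"
        using v RX by (intro vec.span_minimal[OF _ X]) auto
      then have "vec.span (insert v R) \<in> F"
        using v dim_span_insert[OF R, of v] vec.span_superset[of "insert v R"]
        by (simp add: F_def grassmann_vertices_def d_def)
      moreover have "v \<in> vec.span (insert v R)" by (simp add: vec.span_base)
      ultimately show "v \<in> (\<Union>U\<in>F. U - R)" using v by blast
    qed
    show "(\<Union>U\<in>F. U - R) \<subseteq> X - R" using F by blast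
  qed
  moreover have "card (\<Union>U\<in>F. U - R) = (\<Sum>U\<in>F. card (U - R))"
  proof (intro card_UN_disjoint ballI impI)
    fix U W assume "U \<in> F" "W \<in> F" "U \<noteq> W"
    then show "(U - R) \<inter> (W - R) = {}" using span_F by blast
  qed simp_all
  \<comment> \<open>Sizes are compared in \<open>int\<close> because subtraction on
    \<open>nat\<close> is truncated.\<close>
  moreover have "int (card (U - R)) = int q ^ Suc d - int q ^ d" if "U \<in> F" for U
    using F[OF that] R card_mono[of U R]
    by (subst card_Diff_subset) (simp_all add: card_subspace q_def d_def)
  moreover have "int (card (X - R)) = int q ^ (d + e) - int q ^ d"
    using R X RX dim card_mono[of X R]
    by (subst card_Diff_subset) (simp_all add: card_subspace q_def d_def)
  ultimately have "int q ^ (d + e) - int q ^ d = int (card F) * (int q ^ Suc d - int q ^ d)"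
    by simp
  then have "int q ^ d * (int q ^ e - 1) = int q ^ d * ((int q - 1) * int (card F))"
    by (simp add: algebra_simps power_add)
  moreover have q: "2 \<le> q" unfolding q_def by (rule two_le_card_field)
  ultimately have "(int q - 1) * int (qint q e) = (int q - 1) * int (card F)"
    by (simp add: qint_mult)
  then show ?thesis using q by (simp add: F_def d_def q_def)
qed

text \<open>Double counting of pairs \<open>P \<subseteq> U\<close> with \<open>P\<close> one
  dimension above \<open>R\<close> and \<open>U\<close> one below \<open>X\<close>: each
  \<open>U\<close> contains [e-1] such \<open>P\<close>, and each of the [e] spaces \<open>P\<close>
  lies in [e-1] such \<open>U\<close> by induction. Cancelling [e-1] leaves [e].\<close>

lemma card_subspaces_below:
  fixes R X :: "('q::{finite,field} ^ 'n) set"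
  assumes "vec.subspace R" and "vec.subspace X" and "R \<subseteq> X" and "vec.dim X = vec.dim R + e"
  shows "card {U. vec.subspace U \<and> Suc (vec.dim U) = vec.dim X \<and> R \<subseteq> U \<and> U \<subseteq> X} = qint CARD('q) e"
  using assms
proof (induction e arbitrary: R rule: less_induct)
  case (less e)
  note R = less.prems(1) and X = less.prems(2) and RX = less.prems(3) and dim = less.prems(4)
  define q where "q = CARD('q)"
  define H where "H P = {U. vec.subspace U \<and> Suc (vec.dim U) = vec.dim X \<and> P \<subseteq> U \<and> U \<subseteq> X}" for P
  define Pt where "Pt Y = {P \<in> grassmann_vertices (Suc (vec.dim R)). R \<subseteq> P \<and> P \<subseteq> Y}" for Y :: "('q ^ 'n) set"
  \<comment> \<open>\<open>e = 1\<close> is a separate base case: there the factor [e-1] is zero and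
    cannot be cancelled.\<close>
  consider "e = 0" | "e = 1" | e' where "e = Suc (Suc e')"
    by (metis One_nat_def not0_implies_Suc)
  then show ?case
  proof cases
    case 1
    have "U \<notin> H R" for U
      using vec.dim_subset[of R U] dim 1 by (auto simp: H_def)
    then have "H R = {}" by blast
    then show ?thesis using 1 by (simp add: H_def qint_def)
  next
    case 2
    have "U = R" if "U \<in> H R" for U
      using that dim 2 subspace_eq_of_dim[OF R, of U] by (simp add: H_def)
    moreover have "R \<in> H R" using dim R RX 2 by (simp add: H_def)
    ultimately have "H R = {R}" by blast
    then show ?thesis using 2 by (simp add: H_def qint_def)
  next
    case 3
    have "(\<Sum>U\<in>H R. card (Pt U)) = (\<Sum>U\<in>H R. \<Sum>P\<in>Pt X. of_bool (P \<subseteq> U))"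
    proof (rule sum.cong)
      fix U assume U: "U \<in> H R"
      have "Pt U = Pt X \<inter> {P. P \<subseteq> U}" using U by (auto simp: Pt_def H_def)
      then show "card (Pt U) = (\<Sum>P\<in>Pt X. of_bool (P \<subseteq> U))" by simp
    qed simp
    also have "\<dots> = (\<Sum>P\<in>Pt X. \<Sum>U\<in>H R. of_bool (P \<subseteq> U))" by (rule sum.swap)
    also have "\<dots> = (\<Sum>P\<in>Pt X. card (H P))"
    proof (rule sum.cong)
      fix P assume P: "P \<in> Pt X"
      have "H P = H R \<inter> {U. P \<subseteq> U}" using P by (auto simp: Pt_def H_def)
      then show "(\<Sum>U\<in>H R. of_bool (P \<subseteq> U)) = card (H P)" by simp
    qed simp
    finally have swap: "(\<Sum>U\<in>H R. card (Pt U)) = (\<Sum>P\<in>Pt X. card (H P))" .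
    have "card (Pt U) = qint q (Suc e')" if "U \<in> H R" for U
      using that dim 3 R unfolding Pt_def q_def by (intro card_subspaces_above) (auto simp: H_def)
    \<comment> \<open>The induction hypothesis is applied with \<open>P\<close> in the role of
      \<open>R\<close>, at codimension e - 1 in \<open>X\<close>.\<close>
    moreover have "card (H P) = qint q (Suc e')" if "P \<in> Pt X" for P
      using that dim 3 X less.IH[of "Suc e'" P] by (simp add: H_def Pt_def q_def grassmann_vertices_def)
    moreover have "card (Pt X) = qint q e"
      using R X RX dim unfolding Pt_def q_def by (rule card_subspaces_above)
    ultimately have "card (H R) * qint q (Suc e') = qint q e * qint q (Suc e')"
      using swap by simp
    moreover have "qint q (Suc e') > 0"
      using two_le_card_field[where 'q='q] by (simp add: qint_Suc q_def)
    ultimately show ?thesis by (simp add: H_def q_def)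
  qed
qed

section \<open>Common neighbours in Grassmann graphs\<close>

text \<open>Turns an entry of a product of two 0/1 incidence matrices into a cardinality.\<close>

lemma of_bool_mult_eq_card:
  "finite A \<Longrightarrow> (\<Sum>x\<in>A. of_bool (P x) * of_bool (Q x)) = int (card {x\<in>A. P x \<and> Q x})"
  by (simp flip: of_bool_conj) (simp add: Int_def)

text \<open>Empty for \<open>m = 0\<close>, which lets all identities below hold for \<open>k = 1\<close> as well.\<close>

definition corank1_subspaces :: "nat \<Rightarrow> ('q::{finite,field} ^ 'n) set set" where
  "corank1_subspaces m = {R. vec.subspace R \<and> Suc (vec.dim R) = m}"

lemma corank1_subspaces_Suc: "corank1_subspaces (Suc m) = grassmann_vertices m"
  by (simp add: corank1_subspaces_def grassmann_vertices_def)

lemma dim_Int_of_distinct: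
  fixes S T :: "('q::{finite,field} ^ 'n) set"
  assumes "S \<in> grassmann_vertices k" "T \<in> grassmann_vertices k" "S \<noteq> T"
  shows "vec.dim (S \<inter> T) < k"
proof (rule ccontr)
  assume "\<not> vec.dim (S \<inter> T) < k"
  then have "S \<inter> T = X" if "X \<in> {S, T}" for X
    using assms that
    by (intro subspace_eq_of_dim) (auto simp: grassmann_vertices_def intro: vec.subspace_inter)
  then show False using assms(3) by blast
qed

text \<open>Entries of \<open>M M\<^sup>T\<close>. A common hyperplane of distinct \<open>S\<close>
  and \<open>T\<close> lies in \<open>S \<inter> T\<close>, whose dimension is at most k - 1, so it
  is \<open>S \<inter> T\<close> and exists exactly for adjacent vertices.\<close>

lemma card_common_corank1:
  fixes S T :: "('q::{finite,field} ^ 'n) set"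
  assumes S: "S \<in> grassmann_vertices k" and T: "T \<in> grassmann_vertices k"
  shows "card {U \<in> corank1_subspaces k. U \<subseteq> S \<and> U \<subseteq> T} =
    of_bool (grassmann_adj k S T) + qint CARD('q) k * of_bool (S = T)"
proof (cases "S = T")
  case True
  \<comment> \<open>Hyperplanes of \<open>S\<close> are counted as those above the zero
    space.\<close>
  have "card {U. vec.subspace U \<and> Suc (vec.dim U) = vec.dim S \<and> {0} \<subseteq> U \<and> U \<subseteq> S} = qint CARD('q) k"
    using S by (intro card_subspaces_below) (auto simp: grassmann_vertices_def vec.subspace_0)
  moreover have "{U. vec.subspace U \<and> Suc (vec.dim U) = vec.dim S \<and> {0} \<subseteq> U \<and> U \<subseteq> S} =
      {U \<in> corank1_subspaces k. U \<subseteq> S \<and> U \<subseteq> T}"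
    using True S by (auto simp: corank1_subspaces_def grassmann_vertices_def vec.subspace_0)
  ultimately show ?thesis using True grassmann_adj_irrefl[OF S] by simp
next
  case False
  have sub: "vec.subspace (S \<inter> T)"
    using S T by (auto simp: grassmann_vertices_def intro: vec.subspace_inter)
  have "U = S \<inter> T" if U: "U \<in> corank1_subspaces k" "U \<subseteq> S" "U \<subseteq> T" for U
  proof (rule subspace_eq_of_dim)
    show "vec.dim (S \<inter> T) \<le> vec.dim U"
      using dim_Int_of_distinct[OF S T False] U by (auto simp: corank1_subspaces_def)
  qed (use U sub in \<open>auto simp: corank1_subspaces_def\<close>)
  then have "{U \<in> corank1_subspaces k. U \<subseteq> S \<and> U \<subseteq> T} \<subseteq> {S \<inter> T}"
    by blast
  moreover have "S \<inter> T \<in> corank1_subspaces k \<longleftrightarrow> grassmann_adj k S T"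
    using sub by (simp add: corank1_subspaces_def grassmann_adj_def)
  ultimately have "{U \<in> corank1_subspaces k. U \<subseteq> S \<and> U \<subseteq> T} =
      (if grassmann_adj k S T then {S \<inter> T} else {})"
    by auto
  then show ?thesis using False by simp
qed

text \<open>Entries of \<open>M\<^sup>T M\<close>, dually: a common superspace of distinct
  \<open>U\<close> and \<open>W\<close> contains their sum, of dimension at least m + 1, so it
  equals the sum. By the dimension formula the sum has dimension m + 1 exactly when the intersection
  has m - 1.\<close>

lemma card_common_superspaces:
  fixes U W :: "('q::{finite,field} ^ 'n) set"
  assumes U: "U \<in> grassmann_vertices m" and W: "W \<in> grassmann_vertices m"
  shows "card {X \<in> grassmann_vertices (Suc m). U \<subseteq> X \<and> W \<subseteq> X} =
    of_bool (grassmann_adj m U W) + qint CARD('q) (CARD('n) - m) * of_bool (U = W)"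
proof (cases "U = W")
  case True
  \<comment> \<open>Ensures that the truncated difference \<open>CARD('n) - m\<close> is the
    codimension of \<open>U\<close>.\<close>
  have "m \<le> CARD('n)"
    using U vec.dim_subset[OF subset_UNIV, of U]
    by (simp only: grassmann_vertices_def mem_Collect_eq vec_dim_card)
  then have "card {X \<in> grassmann_vertices (Suc (vec.dim U)). U \<subseteq> X \<and> X \<subseteq> UNIV} =
      qint CARD('q) (CARD('n) - m)"
    using U by (intro card_subspaces_above) (auto simp: grassmann_vertices_def vec_dim_card simp del: vec.dim_UNIV)
  then show ?thesis using True U grassmann_adj_irrefl[OF U] by (simp add: grassmann_vertices_def)
next
  case False
  define Y where "Y = {u + w |u w. u \<in> U \<and> w \<in> W}"
  have U': "vec.subspace U" "vec.dim U = m" and W': "vec.subspace W" "vec.dim W = m"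
    using U W by (auto simp: grassmann_vertices_def)
  have dim: "vec.dim Y + vec.dim (U \<inter> W) = 2 * m"
    using vec.dim_sums_Int[OF U'(1) W'(1)] U' W' by (simp add: Y_def)
  have Y: "vec.subspace Y" unfolding Y_def by (rule vec.subspace_sums[OF U'(1) W'(1)])
  have "U \<subseteq> Y" "W \<subseteq> Y"
    using vec.subspace_0[OF U'(1)] vec.subspace_0[OF W'(1)] unfolding Y_def by force+
  have "X = Y" if X: "X \<in> grassmann_vertices (Suc m)" "U \<subseteq> X" "W \<subseteq> X" for X
  proof (rule subspace_eq_of_dim[symmetric])
    show sub: "vec.subspace X" using X by (simp add: grassmann_vertices_def)
    show "Y \<subseteq> X" using X vec.subspace_add[OF sub] by (auto simp: Y_def)
    show "vec.dim X \<le> vec.dim Y"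
      using dim dim_Int_of_distinct[OF U W False] X by (simp add: grassmann_vertices_def)
  qed (rule Y)
  then have "{X \<in> grassmann_vertices (Suc m). U \<subseteq> X \<and> W \<subseteq> X} \<subseteq> {Y}"
    by blast
  moreover have "Y \<in> grassmann_vertices (Suc m) \<longleftrightarrow> vec.dim Y = Suc m"
    using Y by (simp add: grassmann_vertices_def)
  ultimately have "{X \<in> grassmann_vertices (Suc m). U \<subseteq> X \<and> W \<subseteq> X} =
      (if vec.dim Y = Suc m then {Y} else {})"
    using \<open>U \<subseteq> Y\<close> \<open>W \<subseteq> Y\<close> by auto
  moreover have "vec.dim Y = Suc m \<longleftrightarrow> grassmann_adj m U W"
    using dim by (auto simp: grassmann_adj_def)
  ultimately show ?thesis using False by simp
qed

text \<open>Entries of \<open>M N\<close>: for \<open>R \<subseteq> S\<close> these are the lines of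
  the plane S/R, of which there are [2] = q + 1.\<close>

lemma card_between_codim2:
  fixes R S :: "('q::{finite,field} ^ 'n) set"
  assumes R: "R \<in> corank1_subspaces m" and S: "S \<in> grassmann_vertices (Suc m)"
  shows "card {U \<in> grassmann_vertices m. R \<subseteq> U \<and> U \<subseteq> S} = (CARD('q) + 1) * of_bool (R \<subseteq> S)"
proof (cases "R \<subseteq> S")
  case True
  have "card {U \<in> grassmann_vertices (Suc (vec.dim R)). R \<subseteq> U \<and> U \<subseteq> S} = qint CARD('q) 2"
    using R S True by (intro card_subspaces_above) (auto simp: corank1_subspaces_def grassmann_vertices_def)
  then show ?thesis using R True by (auto simp: corank1_subspaces_def qint_def numeral_2_eq_2)
next
  case False
  then have "{U \<in> grassmann_vertices m. R \<subseteq> U \<and> U \<subseteq> S} = {}" by blast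
  then show ?thesis using False by simp
qed

text \<open>The (S,T) entry of the square of \<open>M M\<^sup>T - [m+1] I\<close>, with the square
  of \<open>M M\<^sup>T\<close> reduced through \<open>M\<^sup>T M\<close> and \<open>M N\<close>.
  Integers accommodate the negative coefficients.\<close>

lemma card_common_neighbours:
  fixes S T :: "('q::{finite,field} ^ 'n) set"
  assumes S: "S \<in> grassmann_vertices (Suc m)" and T: "T \<in> grassmann_vertices (Suc m)"
  defines "g e \<equiv> int (qint CARD('q) e)"
  shows "int (card {X \<in> grassmann_vertices (Suc m).
      grassmann_adj (Suc m) S X \<and> grassmann_adj (Suc m) X T}) =
    (int CARD('q) + 1)\<^sup>2 * int (card {R \<in> corank1_subspaces m. R \<subseteq> S \<and> R \<subseteq> T}) +
    (g (CARD('n) - m) - g m - 2 * g (Suc m)) *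
      (of_bool (grassmann_adj (Suc m) S T) + g (Suc m) * of_bool (S = T)) +
    (g (Suc m))\<^sup>2 * of_bool (S = T)"
proof -
  define V :: "('q ^ 'n) set set" where "V = grassmann_vertices (Suc m)"
  define G :: "('q ^ 'n) set set" where "G = grassmann_vertices m"
  define L :: "('q ^ 'n) set set" where "L = corank1_subspaces m"
  define i where "i A B = (of_bool (A \<subseteq> B) :: int)" for A B :: "('q ^ 'n) set"
  \<comment> \<open>\<open>h\<close> is the matrix \<open>M M\<^sup>T\<close>; \<open>k\<close>
    below is the q-integer [m+1], not a dimension.\<close>
  define h where "h A B = (\<Sum>U\<in>G. i U A * i U B)" for A B
  define k where "k = g (Suc m)"
  define c where "c = g (CARD('n) - m) - g m"
  define q1 where "q1 = int CARD('q) + 1"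
  have ST: "S \<in> V" "T \<in> V" using S T by (auto simp: V_def)
  have h: "h A B = of_bool (grassmann_adj (Suc m) A B) + k * of_bool (A = B)"
    if "A \<in> V" "B \<in> V" for A B
    using card_common_corank1[of A "Suc m" B] that
    unfolding h_def i_def of_bool_mult_eq_card[OF finite]
    by (simp add: G_def V_def k_def g_def corank1_subspaces_Suc)
  have MtM: "(\<Sum>X\<in>V. i U X * i W X) = (\<Sum>R\<in>L. i R U * i R W) + c * of_bool (U = W)"
    if "U \<in> G" "W \<in> G" for U W
    using card_common_corank1[of U m W] card_common_superspaces[of U m W] that
    unfolding i_def of_bool_mult_eq_card[OF finite]
    by (simp add: G_def V_def L_def c_def g_def algebra_simps)
  have MN: "(\<Sum>U\<in>G. i R U * i U A) = q1 * i R A" if "R \<in> L" "A \<in> V" for R A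
    using card_between_codim2[of R m A] that
    unfolding i_def of_bool_mult_eq_card[OF finite]
    by (simp add: G_def V_def L_def q1_def)
  have "(\<Sum>X\<in>V. h S X * h X T) = (\<Sum>X\<in>V. \<Sum>U\<in>G. \<Sum>W\<in>G. i U S * i W T * (i U X * i W X))"
    by (simp add: h_def sum_product mult_ac)
  also have "\<dots> = (\<Sum>U\<in>G. \<Sum>W\<in>G. \<Sum>X\<in>V. i U S * i W T * (i U X * i W X))"
    by (subst sum.swap) (intro sum.cong refl sum.swap)
  \<comment> \<open>With the sum over \<open>X\<close> innermost, \<open>M\<^sup>T M\<close> appears
    and is replaced by means of \<open>MtM\<close>.\<close>
  also have "\<dots> = (\<Sum>U\<in>G. \<Sum>W\<in>G. i U S * i W T * ((\<Sum>R\<in>L. i R U * i R W) + c * of_bool (U = W)))"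
    by (intro sum.cong refl) (simp add: MtM flip: sum_distrib_left)
  also have "\<dots> = (\<Sum>U\<in>G. \<Sum>W\<in>G. \<Sum>R\<in>L. (i R U * i U S) * (i R W * i W T)) +
      (\<Sum>U\<in>G. \<Sum>W\<in>G. c * (i U S * i W T) * of_bool (U = W))"
    by (simp add: distrib_left sum.distrib sum_distrib_left mult_ac)
  also have "(\<Sum>U\<in>G. \<Sum>W\<in>G. c * (i U S * i W T) * of_bool (U = W)) = c * h S T"
    by (simp add: h_def sum_distrib_left of_bool_def if_distrib cong: if_cong)
  also have "(\<Sum>U\<in>G. \<Sum>W\<in>G. \<Sum>R\<in>L. (i R U * i U S) * (i R W * i W T)) =
      (\<Sum>R\<in>L. \<Sum>U\<in>G. \<Sum>W\<in>G. (i R U * i U S) * (i R W * i W T))"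
    by (subst sum.swap[of _ L]) (intro sum.cong refl sum.swap)
  \<comment> \<open>For each \<open>R\<close> the double sum factors into two entries of
    \<open>M N\<close>, one at \<open>S\<close> and one at \<open>T\<close>.\<close>
  also have "\<dots> = (\<Sum>R\<in>L. (q1 * i R S) * (q1 * i R T))"
    by (intro sum.cong refl) (simp add: MN ST flip: sum_product)
  also have "\<dots> = q1\<^sup>2 * int (card {R \<in> L. R \<subseteq> S \<and> R \<subseteq> T})"
    unfolding i_def of_bool_mult_eq_card[OF finite, symmetric]
    by (simp only: power2_eq_square mult_ac sum_distrib_left)
  finally have hh: "(\<Sum>X\<in>V. h S X * h X T) = q1\<^sup>2 * int (card {R \<in> L. R \<subseteq> S \<and> R \<subseteq> T}) + c * h S T" .
  \<comment> \<open>Back from \<open>M M\<^sup>T\<close> to the adjacency matrix by subtracting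
    \<open>k\<close> times the identity.\<close>
  have "(\<Sum>X\<in>V. of_bool (grassmann_adj (Suc m) S X) * of_bool (grassmann_adj (Suc m) X T)) =
      (\<Sum>X\<in>V. (h S X - k * of_bool (S = X)) * (h X T - k * of_bool (X = T)))"
    by (intro sum.cong refl) (simp add: h ST)
  also have "\<dots> = (\<Sum>X\<in>V. h S X * h X T - k * (of_bool (S = X) * h X T)
      - k * (h S X * of_bool (X = T)) + k\<^sup>2 * (of_bool (S = X) * of_bool (X = T)))"
    by (intro sum.cong refl) (simp add: algebra_simps power2_eq_square)
  also have "\<dots> = (\<Sum>X\<in>V. h S X * h X T) - k * (\<Sum>X\<in>V. of_bool (S = X) * h X T)
      - k * (\<Sum>X\<in>V. h S X * of_bool (X = T)) + k\<^sup>2 * (\<Sum>X\<in>V. of_bool (S = X) * of_bool (X = T))"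
    by (simp only: sum.distrib sum_subtractf sum_distrib_left)
  also have "(\<Sum>X\<in>V. of_bool (S = X) * h X T) = h S T"
    using ST by (simp add: of_bool_def if_distrib[of "\<lambda>x. x * _"] cong: if_cong)
  also have "(\<Sum>X\<in>V. h S X * of_bool (X = T)) = h S T"
    using ST by (simp add: of_bool_def if_distrib[of "\<lambda>x. _ * x"] cong: if_cong)
  also have "(\<Sum>X\<in>V. of_bool (S = X) * of_bool (X = T)) = (of_bool (S = T) :: int)"
    using ST by (simp add: of_bool_def if_distrib[of "\<lambda>x. x * _"] cong: if_cong)
  finally show ?thesis
    unfolding hh h[OF ST] of_bool_mult_eq_card[OF finite]
    by (simp add: V_def L_def q1_def k_def c_def algebra_simps)
qed

section \<open>Vertices at a given distance, and idempotence as a parity condition\<close>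

text \<open>Coordinate subspaces: \<open>r\<close> of the \<open>k\<close> coordinates of
  \<open>S\<close> are exchanged for \<open>r\<close> others to form \<open>T\<close>, which puts
  the two vertices at distance \<open>r\<close>.\<close>

lemma exists_vertices_with_codim:
  assumes "r \<le> k" "k + r \<le> CARD('n)"
  obtains S T :: "('q::{finite,field} ^ 'n) set"
  where "S \<in> grassmann_vertices k" "T \<in> grassmann_vertices k" "vec.dim (S \<inter> T) + r = k"
proof -
  define E where "E I = {x :: 'q ^ 'n. \<forall>i. i \<notin> I \<longrightarrow> x $ i = 0}" for I
  have dim: "vec.dim (E I) = card I" for I unfolding E_def by (rule dim_substandard_cart)
  have sub: "vec.subspace (E I)" for I by (simp add: vec.subspace_def E_def)
  have Int: "E I \<inter> E J = E (I \<inter> J)" for I J by (auto simp: E_def)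
  obtain I :: "'n set" where I: "card I = k"
    using obtain_subset_with_card_n[of k "UNIV :: 'n set"] assms by auto
  obtain P where P: "P \<subseteq> I" "card P = r"
    using obtain_subset_with_card_n[of r I] assms I by auto
  have "r \<le> card (- I)" using assms I by (simp add: card_Diff_subset Compl_eq_Diff_UNIV)
  then obtain Q where Q: "Q \<subseteq> - I" "card Q = r"
    using obtain_subset_with_card_n[of r "- I"] by auto
  have "card (I - P) = k - r" using P I by (simp add: card_Diff_subset)
  moreover have "card ((I - P) \<union> Q) = card (I - P) + card Q"
    using Q by (intro card_Un_disjoint) auto
  moreover have "I \<inter> ((I - P) \<union> Q) = I - P" using P Q by blast
  ultimately show thesis
    using that[of "E I" "E ((I - P) \<union> Q)"] assms I Q
    by (simp add: grassmann_vertices_def dim sub Int)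
qed

text \<open>An entry of the squared adjacency matrix counts walks of length two modulo 2;
  \<open>ord\<close> carries indices to vertices.\<close>

lemma idempotent_adjacency_matrix_iff:
  fixes ord :: "'v::finite \<Rightarrow> 'a"
  assumes "bij_betw ord UNIV V"
  shows "adjacency_matrix adj ord ** adjacency_matrix adj ord = adjacency_matrix adj ord \<longleftrightarrow>
    (\<forall>S\<in>V. \<forall>T\<in>V. odd (card {X\<in>V. adj S X \<and> adj X T}) \<longleftrightarrow> adj S T)"
proof -
  have V: "V = range ord" using assms by (simp add: bij_betw_def)
  have "(adjacency_matrix adj ord ** adjacency_matrix adj ord) $ i $ j =
      of_nat (card {X\<in>V. adj (ord i) X \<and> adj X (ord j)})" for i j
  proof -
    have "bij_betw ord {l. adj (ord i) (ord l) \<and> adj (ord l) (ord j)}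
        {X\<in>V. adj (ord i) X \<and> adj X (ord j)}"
      using assms by (auto simp: bij_betw_def inj_on_def)
    then have "card {l. adj (ord i) (ord l) \<and> adj (ord l) (ord j)} =
        card {X\<in>V. adj (ord i) X \<and> adj X (ord j)}"
      by (rule bij_betw_same_card)
    moreover have "(adjacency_matrix adj ord ** adjacency_matrix adj ord) $ i $ j =
        (\<Sum>l\<in>UNIV. of_bool (adj (ord i) (ord l) \<and> adj (ord l) (ord j)))"
      unfolding matrix_matrix_mult_def adjacency_matrix_def
      by (simp del: sum_of_bool_eq) (intro sum.cong, auto)
    ultimately show ?thesis by simp
  qed
  moreover have "adjacency_matrix adj ord $ i $ j = of_bool (adj (ord i) (ord j))" for i j
    by (simp add: adjacency_matrix_def)
  moreover have "of_nat n = (of_bool b :: bit) \<longleftrightarrow> (odd n \<longleftrightarrow> b)" for n b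
    by (cases b) (auto simp: even_iff_of_nat_bit)
  ultimately show ?thesis
    unfolding vec_eq_iff V by simp
qed

text \<open>The bounds on \<open>k\<close> supply the witnesses: an edge for odd q, where even n
  must be refuted, and a pair at distance 2 for even q.\<close>

theorem proposition4p9:
  fixes k :: nat
    and ord :: "'v::finite \<Rightarrow> ('q::{finite,field} ^ 'n) set"
  assumes "bij_betw ord UNIV (grassmann_vertices k)"
  shows "(odd CARD('q) \<and> 1 \<le> k \<and> k + 1 \<le> CARD('n) \<longrightarrow>
            (yields_even_LCD_code (grassmann_adj k) ord \<longleftrightarrow> odd CARD('n)))
       \<and> (even CARD('q) \<and> 2 \<le> k \<and> k + 2 \<le> CARD('n) \<longrightarrow>
            \<not> yields_even_LCD_code (grassmann_adj k) ord)"
proof -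
  define V :: "('q ^ 'n) set set" where "V = grassmann_vertices k"
  define c where "c S T = card {X \<in> V. grassmann_adj k S X \<and> grassmann_adj k X T}" for S T
  have "ord i \<in> grassmann_vertices k" for i
    using assms by (auto simp: bij_betw_def)
  then have yields_iff: "yields_even_LCD_code (grassmann_adj k) ord \<longleftrightarrow>
      (\<forall>S\<in>V. \<forall>T\<in>V. odd (c S T) \<longleftrightarrow> grassmann_adj k S T)"
    unfolding c_def V_def idempotent_adjacency_matrix_iff[OF assms, symmetric]
    using idempotent_adjacency_matrix_if_yields yields_if_idempotent_adjacency_matrix
      grassmann_adj_sym grassmann_adj_irrefl by metis
  show ?thesis
  proof (intro conjI impI; elim conjE)
    assume q: "odd CARD('q)" and k: "1 \<le> k" "k + 1 \<le> CARD('n)"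
    then obtain m where m: "k = Suc m" by (cases k) auto
    \<comment> \<open>Modulo 2 the term with (q+1)^2 drops out and [n-m] - [m] becomes n. For
      \<open>S = T\<close> this leaves (n+1)(m+1), which is even for odd n but not always for even
      n; hence the side condition.\<close>
    have parity: "odd (c S T) \<longleftrightarrow> odd CARD('n) \<and> grassmann_adj k S T"
      if "S \<in> V" "T \<in> V" "odd CARD('n) \<or> S \<noteq> T" for S T
    proof -
      have "odd (int (c S T)) \<longleftrightarrow> odd CARD('n) \<and> grassmann_adj k S T"
        using that q k grassmann_adj_irrefl[of S k]
        unfolding c_def V_def m card_common_neighbours[OF that(1,2)[unfolded V_def m]]
        by (cases "even m"; cases "even CARD('n)"; cases "S = T") (simp_all add: even_qint_of_odd)
      then show ?thesis by simp
    qed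
    \<comment> \<open>For even n a single edge violates the criterion, since its ends have an even
      number of common neighbours.\<close>
    obtain S T :: "('q ^ 'n) set" where ST: "S \<in> V" "T \<in> V" "grassmann_adj k S T"
      using exists_vertices_with_codim[OF k] unfolding V_def grassmann_adj_def by metis
    moreover have "S \<noteq> T" using ST grassmann_adj_irrefl unfolding V_def by blast
    ultimately show "yields_even_LCD_code (grassmann_adj k) ord \<longleftrightarrow> odd CARD('n)"
      unfolding yields_iff using parity by blast
  next
    assume q: "even CARD('q)" and k: "2 \<le> k" "k + 2 \<le> CARD('n)"
    then obtain m where m: "k = Suc m" by (cases k) auto
    \<comment> \<open>At distance 2 the only common subspace of dimension m - 1 is
      \<open>S \<inter> T\<close>, and all other terms of \<open>card_common_neighbours\<close>
      vanish.\<close>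
    obtain S T :: "('q ^ 'n) set" where S: "S \<in> V" and T: "T \<in> V" and dim: "vec.dim (S \<inter> T) + 2 = k"
      using exists_vertices_with_codim[OF k] unfolding V_def by metis
    have sub: "vec.subspace (S \<inter> T)"
      using S T by (auto simp: V_def grassmann_vertices_def intro: vec.subspace_inter)
    have "R = S \<inter> T" if "R \<in> corank1_subspaces m" "R \<subseteq> S" "R \<subseteq> T" for R
      using that sub dim by (intro subspace_eq_of_dim) (auto simp: corank1_subspaces_def m)
    moreover have "S \<inter> T \<in> corank1_subspaces m"
      using sub dim by (simp add: corank1_subspaces_def m)
    ultimately have "{R \<in> corank1_subspaces m. R \<subseteq> S \<and> R \<subseteq> T} = {S \<inter> T}"
      by blast
    moreover have "S \<noteq> T"
    proof
      assume "S = T"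
      then show False using dim S by (simp add: V_def grassmann_vertices_def)
    qed
    moreover have not_adj: "\<not> grassmann_adj k S T"
      using dim by (simp add: grassmann_adj_def)
    moreover have "odd (qint CARD('q) e)" if "0 < e" for e
      using odd_qint_of_even[OF q, of "e - 1"] that by simp
    \<comment> \<open>The count is (q+1)^2, odd for even q, although \<open>S\<close> and
      \<open>T\<close> are not adjacent.\<close>
    ultimately have "odd (int (c S T))"
      using q k unfolding c_def V_def m card_common_neighbours[OF S[unfolded V_def m] T[unfolded V_def m]]
      by simp
    then have "odd (c S T)" by simp
    then show "\<not> yields_even_LCD_code (grassmann_adj k) ord"
      unfolding yields_iff using S T not_adj by blast
  qed
qed

end
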